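(* For every integer $n\geqslant 2$, the rank (as a semigroup) of the semigroup $N(\mathcal{PIO}_{n}^{-})$ of all nilpotent elements of $\mathcal{PIO}_n^-$ is $2^{n}-n-1$.
   Context: $\Omega_n=\{1,\ldots,n\}$ with its natural order. A partial transformation of $\Omega_n$ is a map $\alpha$ from a subset $\operatorname{Dom}(\alpha)\subseteq\Omega_n$ (possibly empty) into $\Omega_n$, with image $\operatorname{Im}(\alpha)$. Maps are written on the right and composed from left to right: $x(\alpha\beta)=(x\alpha)\beta$, with $\operatorname{Dom}(\alpha\beta)=\{x\in\operatorname{Dom}(\alpha)\mid x\alpha\in\operatorname{Dom}(\beta)\}$. $\alpha$ is order-preserving if $x\leqslant y$ implies $x\alpha\leqslant y\alpha$ for all $x,y\in\operatorname{Dom}(\alpha)$, and order-decreasing if $x\alpha\leqslant x$ for all $x\in\operatorname{Dom}(\alpha)$. A subset $I\subseteq\Omega_n$ (possibly empty) is an interval if for all $x,y,z\in\Omega_n$, $x\leqslant y\leqslant z$ and $x,z\in I$ imply $y\in I$. $\mathcal{PIO}_n$ is the monoid, under composition, of all order-preserving partial transformations $\alpha$ of $\Omega_n$ such that $\operatorname{Dom}(\alpha)$ and $\operatorname{Im}(\alpha)$ are both intervals of $\Omega_n$, and $\mathcal{PIO}_n^-$ is its submonoid of order-decreasing elements. The zero of these monoids is the empty transformation $0_n$. An element $s$ of a semigroup with zero $0$ is nilpotent if $s^k=0$ for some positive integer $k$. The set $N(\mathcal{PIO}_n^-)$ of nilpotent elements of $\mathcal{PIO}_n^-$ is a subsemigroup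 of $\mathcal{PIO}_n^-$. The rank of a semigroup $S$ is the minimum size of a subset that generates $S$ as a semigroup (every element of $S$ is a product of one or more elements of the subset). *)

theory Defs
  imports "HOL-Algebra.Group"
begin

definition Omega :: "nat \<Rightarrow> nat set"
  where "Omega n = {1..n}"

definition interval_of :: "nat \<Rightarrow> nat set \<Rightarrow> bool"
  where "interval_of n I \<longleftrightarrow> I \<subseteq> Omega n \<and>
    (\<forall>x \<in> Omega n. \<forall>y \<in> Omega n. \<forall>z \<in> Omega n.
       x \<le> y \<and> y \<le> z \<and> x \<in> I \<and> z \<in> I \<longrightarrow> y \<in> I)"

definition partial_transformations :: "nat \<Rightarrow> (nat \<rightharpoonup> nat) set"
  where "partial_transformations n = {\<alpha>. dom \<alpha> \<subseteq> Omega n \<and> ran \<alpha> \<subseteq> Omega n}"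

definition order_preserving :: "(nat \<rightharpoonup> nat) \<Rightarrow> bool"
  where "order_preserving \<alpha> \<longleftrightarrow>
    (\<forall>x \<in> dom \<alpha>. \<forall>y \<in> dom \<alpha>. x \<le> y \<longrightarrow> the (\<alpha> x) \<le> the (\<alpha> y))"

definition order_decreasing :: "(nat \<rightharpoonup> nat) \<Rightarrow> bool"
  where "order_decreasing \<alpha> \<longleftrightarrow> (\<forall>x \<in> dom \<alpha>. the (\<alpha> x) \<le> x)"

text \<open>Maps act on the right, so the product of \<open>\<alpha>\<close> and \<open>\<beta>\<close> applies \<open>\<alpha>\<close> first,
  whereas \<open>\<circ>\<^sub>m\<close> applies its right argument first.\<close>

definition PIO :: "nat \<Rightarrow> (nat \<rightharpoonup> nat) monoid"
  where "PIO n =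
    \<lparr>carrier = {\<alpha> \<in> partial_transformations n. order_preserving \<alpha> \<and>
                  interval_of n (dom \<alpha>) \<and> interval_of n (ran \<alpha>)},
     monoid.mult = (\<lambda>\<alpha> \<beta>. \<beta> \<circ>\<^sub>m \<alpha>),
     one = Some |` Omega n\<rparr>"

definition PIO_minus :: "nat \<Rightarrow> (nat \<rightharpoonup> nat) monoid"
  where "PIO_minus n =
    (PIO n)\<lparr>carrier := {\<alpha> \<in> carrier (PIO n). order_decreasing \<alpha>}\<rparr>"

definition nilpotents :: "('a, 'b) monoid_scheme \<Rightarrow> 'a \<Rightarrow> 'a set"
  where "nilpotents G z = {s \<in> carrier G. \<exists>k::nat. k > 0 \<and> s [^]\<^bsub>G\<^esub> k = z}"

definition N_PIO_minus :: "nat \<Rightarrow> (nat \<rightharpoonup> nat) set"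
  where "N_PIO_minus n = nilpotents (PIO_minus n) Map.empty"

text \<open>The subsemigroup generated by a subset: the unit of \<open>G\<close> is not adjoined.\<close>

inductive_set semigroup_generated :: "('a, 'b) monoid_scheme \<Rightarrow> 'a set \<Rightarrow> 'a set"
  for G and A where
  gen: "a \<in> A \<Longrightarrow> a \<in> semigroup_generated G A"
| prod: "x \<in> semigroup_generated G A \<Longrightarrow> y \<in> semigroup_generated G A \<Longrightarrow>
    x \<otimes>\<^bsub>G\<^esub> y \<in> semigroup_generated G A"

text \<open>The rank of a subsemigroup \<open>S\<close> of \<open>G\<close>; meaningful for finitely generated \<open>S\<close>,
  in particular for all finite \<open>S\<close>.\<close>

definition semigroup_rank :: "('a, 'b) monoid_scheme \<Rightarrow> 'a set \<Rightarrow> nat"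
  where "semigroup_rank G S =
    (LEAST k. \<exists>A. A \<subseteq> S \<and> finite A \<and> card A = k \<and> semigroup_generated G A = S)"

lemma finite_carrier_PIO: "finite (carrier (PIO n))"
proof (rule finite_subset)
  show "carrier (PIO n) \<subseteq> (\<Union>D \<in> Pow (Omega n). {\<alpha>. dom \<alpha> = D \<and> ran \<alpha> \<subseteq> Omega n})"
    by (auto simp: PIO_def partial_transformations_def)
  show "finite (\<Union>D \<in> Pow (Omega n). {\<alpha> :: nat \<rightharpoonup> nat. dom \<alpha> = D \<and> ran \<alpha> \<subseteq> Omega n})"
    by (intro finite_UN_I finite_set_of_finite_maps) (auto simp: Omega_def intro: finite_subset)
qed

lemma finite_N_PIO_minus: "finite (N_PIO_minus n)"
  by (rule finite_subset[OF _ finite_carrier_PIO[of n]])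
     (auto simp: N_PIO_minus_def nilpotents_def PIO_minus_def)

lemma interval_ofD:
  "interval_of n I \<Longrightarrow> x \<in> I \<Longrightarrow> z \<in> I \<Longrightarrow> x \<le> y \<Longrightarrow> y \<le> z \<Longrightarrow> y \<in> Omega n \<Longrightarrow> y \<in> I"
  unfolding interval_of_def by (meson subsetD)

lemma order_preservingD:
  "order_preserving \<alpha> \<Longrightarrow> \<alpha> x = Some u \<Longrightarrow> \<alpha> y = Some v \<Longrightarrow> x \<le> y \<Longrightarrow> u \<le> v"
  unfolding order_preserving_def by (metis domI option.sel)

lemma PIO_mult_closed:
  assumes "\<alpha> \<in> carrier (PIO n)" and "\<beta> \<in> carrier (PIO n)"
  shows "\<beta> \<circ>\<^sub>m \<alpha> \<in> carrier (PIO n)"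
proof -
  have a: "dom \<alpha> \<subseteq> Omega n" "ran \<alpha> \<subseteq> Omega n"
      "\<And>x y u v. \<alpha> x = Some u \<Longrightarrow> \<alpha> y = Some v \<Longrightarrow> x \<le> y \<Longrightarrow> u \<le> v"
      "interval_of n (dom \<alpha>)" "interval_of n (ran \<alpha>)"
    using assms(1)
    by (simp_all add: PIO_def partial_transformations_def) (blast dest: order_preservingD)
  have b: "dom \<beta> \<subseteq> Omega n" "ran \<beta> \<subseteq> Omega n"
      "\<And>x y u v. \<beta> x = Some u \<Longrightarrow> \<beta> y = Some v \<Longrightarrow> x \<le> y \<Longrightarrow> u \<le> v"
      "interval_of n (dom \<beta>)" "interval_of n (ran \<beta>)"
    using assms(2)
    by (simp_all add: PIO_def partial_transformations_def) (blast dest: order_preservingD)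
  have d: "x \<in> dom (\<beta> \<circ>\<^sub>m \<alpha>) \<longleftrightarrow> (\<exists>y z. \<alpha> x = Some y \<and> \<beta> y = Some z)" for x
    by (auto simp: map_comp_def split: option.splits)
  have r: "z \<in> ran (\<beta> \<circ>\<^sub>m \<alpha>) \<longleftrightarrow> (\<exists>x y. \<alpha> x = Some y \<and> \<beta> y = Some z)" for z
    by (auto simp: ran_def map_comp_Some_iff)
  have "dom (\<beta> \<circ>\<^sub>m \<alpha>) \<subseteq> Omega n" "ran (\<beta> \<circ>\<^sub>m \<alpha>) \<subseteq> Omega n"
  proof -
    show "dom (\<beta> \<circ>\<^sub>m \<alpha>) \<subseteq> Omega n" using a(1) d by blast
    show "ran (\<beta> \<circ>\<^sub>m \<alpha>) \<subseteq> Omega n"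
    proof
      fix z assume "z \<in> ran (\<beta> \<circ>\<^sub>m \<alpha>)"
      then obtain x y where "\<alpha> x = Some y" "\<beta> y = Some z" using r by blast
      then show "z \<in> Omega n" using b(2) by (auto simp: ran_def)
    qed
  qed
  moreover have "order_preserving (\<beta> \<circ>\<^sub>m \<alpha>)"
    unfolding order_preserving_def
  proof (intro ballI impI)
    fix x y assume h: "x \<in> dom (\<beta> \<circ>\<^sub>m \<alpha>)" "y \<in> dom (\<beta> \<circ>\<^sub>m \<alpha>)" "x \<le> y"
    obtain u u' where u: "\<alpha> x = Some u" "\<beta> u = Some u'" using h(1) d by blast
    obtain v v' where v: "\<alpha> y = Some v" "\<beta> v = Some v'" using h(2) d by blast
    have "u' \<le> v'" using b(3)[OF u(2) v(2) a(3)[OF u(1) v(1) h(3)]] .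
    then show "the ((\<beta> \<circ>\<^sub>m \<alpha>) x) \<le> the ((\<beta> \<circ>\<^sub>m \<alpha>) y)"
      using u v by (simp add: map_comp_def)
  qed
  moreover have "interval_of n (dom (\<beta> \<circ>\<^sub>m \<alpha>))"
    unfolding interval_of_def
  proof (intro conjI ballI impI)
    fix x y z
    assume om: "x \<in> Omega n" "y \<in> Omega n" "z \<in> Omega n"
      and h: "x \<le> y \<and> y \<le> z \<and> x \<in> dom (\<beta> \<circ>\<^sub>m \<alpha>) \<and> z \<in> dom (\<beta> \<circ>\<^sub>m \<alpha>)"
    obtain u u' where u: "\<alpha> x = Some u" "\<beta> u = Some u'" using h d by blast
    obtain w w' where w: "\<alpha> z = Some w" "\<beta> w = Some w'" using h d by blast
    have "y \<in> dom \<alpha>" using interval_ofD[OF a(4) domI domI] om h u w by blast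
    then obtain v where v: "\<alpha> y = Some v" by auto
    have "u \<le> v" "v \<le> w" using a(3)[OF u(1) v] a(3)[OF v w(1)] h by auto
    moreover have "u \<in> Omega n" "v \<in> Omega n" "w \<in> Omega n"
      using a(2) u v w by (auto simp: ran_def)
    ultimately have "v \<in> dom \<beta>" using interval_ofD[OF b(4) domI domI] u w by blast
    then show "y \<in> dom (\<beta> \<circ>\<^sub>m \<alpha>)" using v d by auto
  qed fact
  moreover have "interval_of n (ran (\<beta> \<circ>\<^sub>m \<alpha>))"
    unfolding interval_of_def
  proof (intro conjI ballI impI)
    fix x y z
    assume om: "x \<in> Omega n" "y \<in> Omega n" "z \<in> Omega n"
      and h: "x \<le> y \<and> y \<le> z \<and> x \<in> ran (\<beta> \<circ>\<^sub>m \<alpha>) \<and> z \<in> ran (\<beta> \<circ>\<^sub>m \<alpha>)"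
    obtain p u where u: "\<alpha> p = Some u" "\<beta> u = Some x" using h r by blast
    obtain q w where w: "\<alpha> q = Some w" "\<beta> w = Some z" using h r by blast
    show "y \<in> ran (\<beta> \<circ>\<^sub>m \<alpha>)"
    proof (cases "y = x \<or> y = z")
      case True then show ?thesis using h by auto
    next
      case False
      have "x \<in> ran \<beta>" "z \<in> ran \<beta>" using u w by (auto simp: ran_def)
      then have "y \<in> ran \<beta>" using interval_ofD[OF b(5)] om h by blast
      then obtain v where v: "\<beta> v = Some y" by (auto simp: ran_def)
      have "u \<le> v" using b(3)[OF v u(2)] False h by linarith
      moreover have "v \<le> w" using b(3)[OF w(2) v] False h by linarith
      moreover have "u \<in> ran \<alpha>" "w \<in> ran \<alpha>" using u w by (auto simp: ran_def)
      moreover have "u \<in> Omega n" "v \<in> Omega n" "w \<in> Omega n"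
        using b(1) u v w by auto
      ultimately have "v \<in> ran \<alpha>" using interval_ofD[OF a(5)] by blast
      then show ?thesis using v r by (auto simp: ran_def)
    qed
  qed fact
  ultimately show ?thesis by (simp add: PIO_def partial_transformations_def)
qed

lemma PIO_one_closed: "Some |` Omega n \<in> carrier (PIO n)"
proof -
  have "dom (Some |` Omega n) = Omega n" "ran (Some |` Omega n) = Omega n"
    by (auto simp: ran_def restrict_map_def dom_def)
  then show ?thesis
    by (auto simp: PIO_def partial_transformations_def order_preserving_def interval_of_def)
qed

lemma PIO_one_left:
  assumes "\<alpha> \<in> carrier (PIO n)" shows "\<alpha> \<circ>\<^sub>m (Some |` Omega n) = \<alpha>"
proof
  fix x show "(\<alpha> \<circ>\<^sub>m (Some |` Omega n)) x = \<alpha> x"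
    using assms by (cases "\<alpha> x")
      (auto simp: PIO_def partial_transformations_def map_comp_def restrict_map_def)
qed

lemma PIO_one_right:
  assumes "\<alpha> \<in> carrier (PIO n)" shows "(Some |` Omega n) \<circ>\<^sub>m \<alpha> = \<alpha>"
proof
  fix x show "((Some |` Omega n) \<circ>\<^sub>m \<alpha>) x = \<alpha> x"
    using assms by (cases "\<alpha> x")
      (auto simp: PIO_def partial_transformations_def map_comp_def restrict_map_def ran_def)
qed

lemma map_comp_assoc: "(h \<circ>\<^sub>m g) \<circ>\<^sub>m f = h \<circ>\<^sub>m (g \<circ>\<^sub>m f)"
  by (auto simp: map_comp_def fun_eq_iff split: option.splits)

lemma PIO_mult [simp]: "\<alpha> \<otimes>\<^bsub>PIO n\<^esub> \<beta> = \<beta> \<circ>\<^sub>m \<alpha>"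
  and PIO_one [simp]: "\<one>\<^bsub>PIO n\<^esub> = Some |` Omega n"
  by (simp_all add: PIO_def)

lemma PIO_minus_mult [simp]: "\<alpha> \<otimes>\<^bsub>PIO_minus n\<^esub> \<beta> = \<beta> \<circ>\<^sub>m \<alpha>"
  and PIO_minus_one [simp]: "\<one>\<^bsub>PIO_minus n\<^esub> = Some |` Omega n"
  and PIO_minus_carrier:
    "\<alpha> \<in> carrier (PIO_minus n) \<longleftrightarrow> \<alpha> \<in> carrier (PIO n) \<and> order_decreasing \<alpha>"
  by (simp_all add: PIO_minus_def PIO_def)

lemma monoid_PIO: "monoid (PIO n)"
  by (rule monoidI)
     (simp_all add: PIO_mult_closed PIO_one_closed PIO_one_left PIO_one_right map_comp_assoc)

lemma monoid_PIO_minus: "monoid (PIO_minus n)"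
proof (rule monoidI)
  have "order_decreasing (Some |` Omega n)"
    by (auto simp: order_decreasing_def restrict_map_def dom_def split: if_splits)
  then show "\<one>\<^bsub>PIO_minus n\<^esub> \<in> carrier (PIO_minus n)"
    by (simp add: PIO_minus_carrier PIO_one_closed)
next
  fix \<alpha> \<beta> assume h: "\<alpha> \<in> carrier (PIO_minus n)" "\<beta> \<in> carrier (PIO_minus n)"
  have "order_decreasing (\<beta> \<circ>\<^sub>m \<alpha>)"
    unfolding order_decreasing_def
  proof
    fix x assume "x \<in> dom (\<beta> \<circ>\<^sub>m \<alpha>)"
    then obtain y z where yz: "\<alpha> x = Some y" "\<beta> y = Some z"
      by (auto simp: map_comp_Some_iff)
    have "the (\<alpha> x) \<le> x" "the (\<beta> y) \<le> y"
      using h yz unfolding PIO_minus_carrier order_decreasing_def by blast+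
    then show "the ((\<beta> \<circ>\<^sub>m \<alpha>) x) \<le> x"
      using yz by (simp add: map_comp_def)
  qed
  with h show "\<alpha> \<otimes>\<^bsub>PIO_minus n\<^esub> \<beta> \<in> carrier (PIO_minus n)"
    by (simp add: PIO_minus_carrier PIO_mult_closed)
qed (simp_all add: PIO_minus_carrier PIO_one_left PIO_one_right map_comp_assoc)

end

theory Submission
  imports Defs
begin

text \<open>
  An order-decreasing element \<open>\<alpha>\<close> is nilpotent exactly when it has no fixed point, that is, when
  \<open>x\<alpha> < x\<close> on the whole domain (\<open>N_PIO_minus_iff\<close>).  A product of two such maps moves every point
  of its domain down by at least two.  Hence the maps \<open>\<alpha>\<close> that move some point down by exactly one,
  say \<open>(x + 1)\<alpha> = x\<close>, are not products, and every generating set must contain all of them.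

  They also suffice.  If \<open>\<alpha>\<close> moves every point down by at least two, then \<open>\<alpha> = \<alpha>' \<sigma>\<close>, where \<open>\<alpha>'\<close>
  raises all values of \<open>\<alpha>\<close> by one and \<open>\<sigma>\<close> is the shift \<open>x \<mapsto> x - 1\<close> on \<open>{2..n}\<close>; now \<open>\<alpha>'\<close> is again
  nilpotent, and repeating the step must end at a map with a drop of one, unless \<open>\<alpha>\<close> is empty.  The
  empty map is the square of \<open>2 \<mapsto> 1\<close>.  So the rank is the number of maps with a drop of one
  (\<open>semigroup_rank_eq_card\<close>).

  These maps are counted by the subsets of \<open>{1..n}\<close> with at least two elements.  As domain and image
  are intervals, the value of \<open>\<alpha>\<close> grows by \<open>0\<close> or \<open>1\<close> between neighbouring points, so the drop
  \<open>x - x\<alpha>\<close> is least at the left end \<open>m + 1\<close> of the domain, and there the map takes the value \<open>m\<close>.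
  The map is then determined by \<open>m\<close>, by the right end \<open>M > m\<close> of its domain, and by an arbitrary set
  of points strictly between \<open>m\<close> and \<open>M\<close> after which it grows.  Together these form a set with
  minimum \<open>m\<close> and maximum \<open>M\<close> (\<open>bij_betw_staircase\<close>).
\<close>

section \<open>Ranks from indecomposable elements\<close>

text \<open>An element of \<open>S\<close> that is no product in \<open>S\<close> can only be generated by being a generator, so a
  generating set of indecomposable elements is contained in every other generating set.\<close>

lemma semigroup_rank_eq_card:
  fixes G (structure)
  assumes "finite S" "I \<subseteq> S" "semigroup_generated G I = S"
    and indec: "\<And>x y. x \<in> S \<Longrightarrow> y \<in> S \<Longrightarrow> x \<otimes> y \<notin> I"
  shows "semigroup_rank G S = card I"
  unfolding semigroup_rank_def
proof (rule Least_equality)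
  show "\<exists>A\<subseteq>S. finite A \<and> card A = card I \<and> semigroup_generated G A = S"
    using assms finite_subset by blast
next
  fix k
  assume "\<exists>A\<subseteq>S. finite A \<and> card A = k \<and> semigroup_generated G A = S"
  then obtain A where A: "finite A" "card A = k" "semigroup_generated G A = S"
    by blast
  have "I \<subseteq> A"
  proof
    fix x assume "x \<in> I"
    with \<open>I \<subseteq> S\<close> A have "x \<in> semigroup_generated G A"
      by blast
    then show "x \<in> A"
      by cases (use \<open>x \<in> I\<close> A indec in blast)+
  qed
  with A show "card I \<le> k"
    using card_mono by blast
qed

section \<open>The nilpotent order-decreasing maps\<close>

lemma PIO_carrier:
  "\<alpha> \<in> carrier (PIO n) \<longleftrightarrow> dom \<alpha> \<subseteq> Omega n \<and> ran \<alpha> \<subseteq> Omega n \<and> order_preserving \<alpha> \<and>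
    interval_of n (dom \<alpha>) \<and> interval_of n (ran \<alpha>)"
  by (auto simp: PIO_def partial_transformations_def)

lemma PIO_bounds:
  assumes "\<alpha> \<in> carrier (PIO n)" "\<alpha> x = Some y"
  shows "1 \<le> x" "x \<le> n" "1 \<le> y" "y \<le> n"
  using assms by (auto simp: PIO_carrier Omega_def dom_def ran_def subset_iff)

text \<open>A fixed point survives in every power; conversely, if every point of the domain moves down,
  then the points of the domain of the \<open>k\<close>-th power move down by at least \<open>k\<close>, which is impossible
  for \<open>k > n\<close>.\<close>

lemma N_PIO_minus_iff:
  "\<alpha> \<in> N_PIO_minus n \<longleftrightarrow> \<alpha> \<in> carrier (PIO n) \<and> (\<forall>x y. \<alpha> x = Some y \<longrightarrow> y < x)"
proof (intro iffI conjI allI impI)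
  interpret M: monoid "PIO_minus n"
    by (rule monoid_PIO_minus)
  assume "\<alpha> \<in> N_PIO_minus n"
  then obtain k where c: "\<alpha> \<in> carrier (PIO_minus n)"
    and k: "\<alpha> [^]\<^bsub>PIO_minus n\<^esub> (k::nat) = Map.empty"
    by (auto simp: N_PIO_minus_def nilpotents_def)
  show c': "\<alpha> \<in> carrier (PIO n)"
    using c by (simp add: PIO_minus_carrier)
  fix x y assume xy: "\<alpha> x = Some y"
  have "y \<le> x"
    using c xy unfolding PIO_minus_carrier order_decreasing_def by (metis domI option.sel)
  moreover have "y \<noteq> x"
  proof
    assume "y = x"
    then have "(\<alpha> [^]\<^bsub>PIO_minus n\<^esub> (j::nat)) x = Some x" for j
      using xy PIO_bounds[OF c' xy]
      by (induction j) (auto simp: Omega_def restrict_map_def map_comp_def)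
    from this[of k] k show False
      by simp
  qed
  ultimately show "y < x"
    by simp
next
  interpret M: monoid "PIO_minus n"
    by (rule monoid_PIO_minus)
  assume *: "\<alpha> \<in> carrier (PIO n) \<and> (\<forall>x y. \<alpha> x = Some y \<longrightarrow> y < x)"
  then have "order_decreasing \<alpha>"
    by (auto simp: order_decreasing_def intro: less_imp_le)
  with * have c: "\<alpha> \<in> carrier (PIO_minus n)"
    by (simp add: PIO_minus_carrier)
  have drop: "y + k \<le> x \<and> x \<le> n" if "(\<alpha> [^]\<^bsub>PIO_minus n\<^esub> (k::nat)) x = Some y" for k x y
    using that
  proof (induction k arbitrary: y)
    case 0
    then show ?case
      by (auto simp: Omega_def restrict_map_def split: if_splits)
  next
    case (Suc k)
    then obtain z where "(\<alpha> [^]\<^bsub>PIO_minus n\<^esub> k) x = Some z" "\<alpha> z = Some y"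
      by (auto simp: map_comp_Some_iff)
    with Suc.IH[of z] * have "z + k \<le> x" "x \<le> n" "y < z"
      by blast+
    then show ?case
      by simp
  qed
  have "\<alpha> [^]\<^bsub>PIO_minus n\<^esub> Suc n = Map.empty"
  proof
    fix x
    show "(\<alpha> [^]\<^bsub>PIO_minus n\<^esub> Suc n) x = None"
      using drop[of "Suc n" x] by (cases "(\<alpha> [^]\<^bsub>PIO_minus n\<^esub> Suc n) x") auto
  qed
  with c show "\<alpha> \<in> N_PIO_minus n"
    unfolding N_PIO_minus_def nilpotents_def by blast
qed

lemma N_PIO_minus_mult_closed:
  assumes "\<alpha> \<in> N_PIO_minus n" "\<beta> \<in> N_PIO_minus n"
  shows "\<beta> \<circ>\<^sub>m \<alpha> \<in> N_PIO_minus n"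
  using assms unfolding N_PIO_minus_iff map_comp_Some_iff
  by (meson PIO_mult_closed less_trans)

section \<open>Maps on intervals that grow by at most one\<close>

lemma image_atLeastAtMost_unit_steps:
  fixes f :: "nat \<Rightarrow> nat"
  assumes "a \<le> b" and step: "\<And>x. f x \<le> f (Suc x) \<and> f (Suc x) \<le> Suc (f x)"
  shows "f ` {a..b} = {f a..f b}"
  using \<open>a \<le> b\<close>
proof (induction b rule: dec_induct)
  case (step b)
  have "f a \<le> f b"
    using lift_Suc_mono_le[of f a b] assms(2) step.hyps by blast
  with step assms(2)[of b] show ?case
    by (auto simp: atLeastAtMostSuc_conv)
qed simp

lemma PIO_intro:
  assumes "1 \<le> a" "a \<le> b" "b \<le> n" "1 \<le> f a" "f b \<le> n"
    and step: "\<And>x. f x \<le> f (Suc x) \<and> f (Suc x) \<le> Suc (f x)"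
    and \<alpha>: "\<alpha> = (\<lambda>x. if x \<in> {a..b} then Some (f x) else None)"
  shows "\<alpha> \<in> carrier (PIO n)"
proof -
  have "dom \<alpha> = {a..b}"
    by (auto simp: \<alpha> split: if_splits)
  moreover have "ran \<alpha> = f ` {a..b}"
    by (auto simp: \<alpha> ran_def)
  moreover have "mono f"
    using step by (simp add: mono_iff_le_Suc)
  ultimately show ?thesis
    using assms(1-5) image_atLeastAtMost_unit_steps[of a b f] step
    by (auto simp: PIO_carrier Omega_def interval_of_def order_preserving_def \<alpha> dest: monoD
        intro: order_trans)
qed

text \<open>A value skipped between neighbouring points would be missing from the image, by monotonicity.\<close>

lemma PIO_step:
  assumes \<alpha>: "\<alpha> \<in> carrier (PIO n)" and u: "\<alpha> x = Some u" and v: "\<alpha> (Suc x) = Some v"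
  shows "v = u \<or> v = Suc u"
proof (rule ccontr)
  have op: "order_preserving \<alpha>" and ran: "interval_of n (ran \<alpha>)"
    using \<alpha> by (auto simp: PIO_carrier)
  assume "\<not> ?thesis"
  with order_preservingD[OF op u v] have gap: "Suc u < v"
    by simp
  then have "Suc u \<in> ran \<alpha>"
    using interval_ofD[OF ran, of u v "Suc u"] u v PIO_bounds[OF \<alpha> v]
    by (auto simp: ran_def Omega_def)
  then obtain z where z: "\<alpha> z = Some (Suc u)"
    by (auto simp: ran_def)
  show False
    using order_preservingD[OF op z u] order_preservingD[OF op v z] gap
    by (cases "z \<le> x") auto
qed

lemma PIO_dom:
  assumes "\<alpha> \<in> carrier (PIO n)" "\<alpha> \<noteq> Map.empty"
  obtains a b where "1 \<le> a" "a \<le> b" "b \<le> n" "dom \<alpha> = {a..b}"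
proof -
  have sub: "dom \<alpha> \<subseteq> {1..n}" and int: "interval_of n (dom \<alpha>)"
    using assms by (auto simp: PIO_carrier Omega_def)
  have fin: "finite (dom \<alpha>)" and ne: "dom \<alpha> \<noteq> {}"
    using sub finite_subset assms by auto
  have mem: "Min (dom \<alpha>) \<in> dom \<alpha>" "Max (dom \<alpha>) \<in> dom \<alpha>"
    using fin ne by auto
  have "{Min (dom \<alpha>)..Max (dom \<alpha>)} \<subseteq> dom \<alpha>"
  proof
    fix x assume x: "x \<in> {Min (dom \<alpha>)..Max (dom \<alpha>)}"
    moreover have "Min (dom \<alpha>) \<in> {1..n}" "Max (dom \<alpha>) \<in> {1..n}"
      using mem sub by blast+
    ultimately show "x \<in> dom \<alpha>"
      by (intro interval_ofD[OF int mem]) (auto simp: Omega_def)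
  qed
  moreover have "dom \<alpha> \<subseteq> {Min (dom \<alpha>)..Max (dom \<alpha>)}"
    using fin by (meson Min_le Max_ge atLeastAtMost_iff subsetI)
  ultimately have "dom \<alpha> = {Min (dom \<alpha>)..Max (dom \<alpha>)}"
    by (rule equalityI[rotated])
  moreover have "1 \<le> Min (dom \<alpha>)" "Max (dom \<alpha>) \<le> n" "Min (dom \<alpha>) \<le> Max (dom \<alpha>)"
    using subsetD[OF sub mem(1)] subsetD[OF sub mem(2)] Min_le[OF fin mem(2)] by simp_all
  ultimately show thesis
    using that by blast
qed

section \<open>Generation by the maps with a drop of one\<close>

definition unit_drop_maps :: "nat \<Rightarrow> (nat \<rightharpoonup> nat) set"
  where "unit_drop_maps n = {\<alpha> \<in> N_PIO_minus n. \<exists>x. \<alpha> (Suc x) = Some x}"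

lemma unit_drop_maps_indecomposable:
  assumes "\<alpha> \<in> N_PIO_minus n" "\<beta> \<in> N_PIO_minus n"
  shows "\<beta> \<circ>\<^sub>m \<alpha> \<notin> unit_drop_maps n"
  using assms by (fastforce simp: unit_drop_maps_def N_PIO_minus_iff map_comp_Some_iff)

definition shift :: "nat \<Rightarrow> (nat \<rightharpoonup> nat)"
  where "shift n = (\<lambda>x. if x \<in> {2..n} then Some (x - 1) else None)"

lemma shift_in_unit_drop_maps:
  assumes "n \<ge> 2"
  shows "shift n \<in> unit_drop_maps n"
proof -
  have "shift n \<in> carrier (PIO n)"
    using assms by (intro PIO_intro[where a = 2 and b = n and f = "\<lambda>x. x - 1"])
      (auto simp: shift_def)
  moreover have "shift n (Suc 1) = Some 1"
    using assms by (simp add: shift_def)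
  ultimately show ?thesis
    unfolding unit_drop_maps_def N_PIO_minus_iff
    by (auto simp: shift_def split: if_splits)
qed

lemma two_to_one_in_unit_drop_maps:
  assumes "n \<ge> 2"
  shows "[2 \<mapsto> 1] \<in> unit_drop_maps n"
proof -
  have "[2 \<mapsto> 1] \<in> carrier (PIO n)"
    using assms by (intro PIO_intro[where a = 2 and b = 2 and f = "\<lambda>x. x - 1"])
      (auto simp: fun_eq_iff)
  moreover have "[2 \<mapsto> 1] (Suc 1) = Some (1::nat)"
    by simp
  ultimately show ?thesis
    unfolding unit_drop_maps_def N_PIO_minus_iff
    by (auto split: if_splits)
qed

definition raise :: "(nat \<rightharpoonup> nat) \<Rightarrow> (nat \<rightharpoonup> nat)"
  where "raise \<alpha> = map_option Suc \<circ> \<alpha>"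

lemma raise_Some_iff: "raise \<alpha> x = Some y \<longleftrightarrow> (\<exists>z. \<alpha> x = Some z \<and> y = Suc z)"
  by (auto simp: raise_def)

text \<open>The hypothesis leaves room for the raised values: they stay strictly below their arguments,
  hence also within \<open>{1..n}\<close>.\<close>

lemma raise_in_N_PIO_minus:
  assumes \<alpha>: "\<alpha> \<in> N_PIO_minus n" and drop: "\<And>x y. \<alpha> x = Some y \<Longrightarrow> Suc y < x"
  shows "raise \<alpha> \<in> N_PIO_minus n"
proof -
  have c: "\<alpha> \<in> carrier (PIO n)"
    using \<alpha> by (simp add: N_PIO_minus_iff)
  have dom: "dom (raise \<alpha>) = dom \<alpha>"
    by (auto simp: raise_def dom_def)
  have ran: "ran (raise \<alpha>) = Suc ` ran \<alpha>"
    by (auto simp: ran_def raise_Some_iff)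
  have ran_sub: "Suc ` ran \<alpha> \<subseteq> Omega n"
  proof (clarsimp simp: ran_def Omega_def)
    fix x y assume xy: "\<alpha> x = Some y"
    show "Suc y \<le> n"
      using drop[OF xy] PIO_bounds[OF c xy] by simp
  qed
  have int: "interval_of n (ran \<alpha>)"
    using c by (simp add: PIO_carrier)
  have "interval_of n (Suc ` ran \<alpha>)"
    unfolding interval_of_def
  proof (intro conjI ballI impI ran_sub)
    fix x y z
    assume "y \<in> Omega n" and *: "x \<le> y \<and> y \<le> z \<and> x \<in> Suc ` ran \<alpha> \<and> z \<in> Suc ` ran \<alpha>"
    then obtain x' z' where x': "x = Suc x'" "x' \<in> ran \<alpha>" and z': "z = Suc z'" "z' \<in> ran \<alpha>"
      by blast
    have le: "x' \<le> y - 1" "y - 1 \<le> z'" "y = Suc (y - 1)"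
      using * x'(1) z'(1) by linarith+
    moreover have "x' \<in> Omega n"
      using x' c by (auto simp: PIO_carrier)
    ultimately have "y - 1 \<in> Omega n"
      using \<open>y \<in> Omega n\<close> by (simp add: Omega_def)
    then have "y - 1 \<in> ran \<alpha>"
      using interval_ofD[OF int x'(2) z'(2) le(1,2)] by blast
    with le(3) show "y \<in> Suc ` ran \<alpha>"
      by blast
  qed
  moreover have "order_preserving (raise \<alpha>)"
    unfolding order_preserving_def
  proof (intro ballI impI)
    fix x y assume *: "x \<in> dom (raise \<alpha>)" "y \<in> dom (raise \<alpha>)" "x \<le> y"
    then obtain u v where uv: "\<alpha> x = Some u" "\<alpha> y = Some v"
      unfolding dom by blast
    have "order_preserving \<alpha>"
      using c by (simp add: PIO_carrier)
    then have "u \<le> v"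
      using uv *(3) by (rule order_preservingD)
    with uv show "the (raise \<alpha> x) \<le> the (raise \<alpha> y)"
      by (simp add: raise_def)
  qed
  ultimately have "raise \<alpha> \<in> carrier (PIO n)"
    using c ran_sub by (simp add: PIO_carrier dom ran)
  then show ?thesis
    using drop by (auto simp: N_PIO_minus_iff raise_Some_iff)
qed

lemma shift_comp_raise:
  assumes "\<alpha> \<in> carrier (PIO n)" "raise \<alpha> \<in> carrier (PIO n)"
  shows "shift n \<circ>\<^sub>m raise \<alpha> = \<alpha>"
proof
  fix x
  show "(shift n \<circ>\<^sub>m raise \<alpha>) x = \<alpha> x"
  proof (cases "\<alpha> x")
    case None
    then show ?thesis
      by (simp add: raise_def)
  next
    case (Some y)
    then have "raise \<alpha> x = Some (Suc y)"
      by (simp add: raise_def)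
    with Some show ?thesis
      using PIO_bounds[OF assms(1) Some] PIO_bounds[OF assms(2), of x "Suc y"]
      by (simp add: shift_def)
  qed
qed

text \<open>Raising a map shrinks the drop at each point of its domain by one, so the drop at any single
  point can serve as the induction measure.\<close>

lemma nonempty_generated_by_unit_drop_maps:
  assumes "n \<ge> 2" "\<alpha> \<in> N_PIO_minus n" "\<alpha> x = Some y"
  shows "\<alpha> \<in> semigroup_generated (PIO_minus n) (unit_drop_maps n)"
  using assms(2,3)
proof (induction "x - y" arbitrary: \<alpha> y rule: less_induct)
  case less
  show ?case
  proof (cases "\<alpha> \<in> unit_drop_maps n")
    case True
    then show ?thesis
      by (rule semigroup_generated.gen)
  next
    case False
    then have no_drop: "\<alpha> (Suc v) \<noteq> Some v" for v
      using less.prems(1) by (auto simp: unit_drop_maps_def)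
    have drop: "Suc v < u" if uv: "\<alpha> u = Some v" for u v
    proof -
      have "v < u"
        using less.prems(1) uv by (simp add: N_PIO_minus_iff)
      moreover have "u \<noteq> Suc v"
        using no_drop uv by blast
      ultimately show ?thesis
        by simp
    qed
    have raised: "raise \<alpha> \<in> N_PIO_minus n"
      using raise_in_N_PIO_minus[OF less.prems(1)] drop by blast
    have "raise \<alpha> x = Some (Suc y)"
      using less.prems(2) by (simp add: raise_def)
    moreover have "x - Suc y < x - y"
      using drop[OF less.prems(2)] by simp
    ultimately have "raise \<alpha> \<in> semigroup_generated (PIO_minus n) (unit_drop_maps n)"
      using less.hyps raised by blast
    then have "raise \<alpha> \<otimes>\<^bsub>PIO_minus n\<^esub> shift n
        \<in> semigroup_generated (PIO_minus n) (unit_drop_maps n)"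
      by (rule semigroup_generated.prod)
        (rule semigroup_generated.gen[OF shift_in_unit_drop_maps[OF \<open>n \<ge> 2\<close>]])
    then show ?thesis
      using shift_comp_raise less.prems(1) raised by (simp add: N_PIO_minus_iff)
  qed
qed

lemma generated_by_unit_drop_maps:
  assumes "n \<ge> 2"
  shows "semigroup_generated (PIO_minus n) (unit_drop_maps n) = N_PIO_minus n"
proof (intro subset_antisym subsetI)
  fix \<alpha>
  assume "\<alpha> \<in> semigroup_generated (PIO_minus n) (unit_drop_maps n)"
  then show "\<alpha> \<in> N_PIO_minus n"
    by induction (simp_all add: unit_drop_maps_def N_PIO_minus_mult_closed)
next
  fix \<alpha>
  assume \<alpha>: "\<alpha> \<in> N_PIO_minus n"
  show "\<alpha> \<in> semigroup_generated (PIO_minus n) (unit_drop_maps n)"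
  proof (cases "\<alpha> = Map.empty")
    case True
    have "\<alpha> = [2 \<mapsto> 1] \<otimes>\<^bsub>PIO_minus n\<^esub> [2 \<mapsto> 1]"
      by (simp add: True map_comp_def fun_eq_iff)
    also have "\<dots> \<in> semigroup_generated (PIO_minus n) (unit_drop_maps n)"
      using two_to_one_in_unit_drop_maps[OF assms]
      by (intro semigroup_generated.prod semigroup_generated.gen)
    finally show ?thesis .
  next
    case False
    then obtain x y where "\<alpha> x = Some y"
      by (metis not_Some_eq)
    then show ?thesis
      using nonempty_generated_by_unit_drop_maps assms \<alpha> by blast
  qed
qed

section \<open>Counting the maps with a drop of one\<close>

text \<open>The domain starts at \<open>Min B + 1\<close>, where the value is \<open>Min B\<close>; after that, the points of \<open>B\<close> strictly
  between \<open>Min B\<close> and \<open>Max B\<close> are the ones after which the staircase goes up.\<close>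

definition staircase :: "nat set \<Rightarrow> (nat \<rightharpoonup> nat)"
  where "staircase B = (\<lambda>x. if x \<in> {Suc (Min B)..Max B}
    then Some (Min B + card (B \<inter> {Min B<..<x})) else None)"

lemma card_Int_greaterThanLessThan_Suc:
  fixes m x :: nat
  shows "card (B \<inter> {m<..<Suc x}) = card (B \<inter> {m<..<x}) + (if m < x \<and> x \<in> B then 1 else 0)"
proof -
  have "B \<inter> {m<..<Suc x} =
      (if m < x \<and> x \<in> B then insert x (B \<inter> {m<..<x}) else B \<inter> {m<..<x})"
    by (auto simp: less_Suc_eq)
  then show ?thesis
    by simp
qed

lemma Min_less_Max:
  fixes B :: "nat set"
  assumes "2 \<le> card B"
  shows "finite B" "Min B < Max B" "Min B \<in> B" "Max B \<in> B"
proof -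
  show fin: "finite B"
    using assms card.infinite by force
  have "B \<noteq> {}"
    using assms by auto
  with fin show mem: "Min B \<in> B" "Max B \<in> B"
    by auto
  have "B \<subseteq> {Min B..Max B}"
    using fin by auto
  then have "card B \<le> card {Min B..Max B}"
    by (intro card_mono) auto
  with assms show "Min B < Max B"
    by auto
qed

lemma staircase_in_unit_drop_maps:
  assumes "B \<subseteq> {1..n}" "2 \<le> card B"
  shows "staircase B \<in> unit_drop_maps n"
proof -
  note B = Min_less_Max[OF assms(2)]
  have bounds: "1 \<le> Min B" "Max B \<le> n"
    using B assms(1) by auto
  have card: "card (B \<inter> {Min B<..<x}) \<le> x - Suc (Min B)" for x
    using card_mono[of "{Min B<..<x}" "B \<inter> {Min B<..<x}"] by simp
  have "staircase B \<in> carrier (PIO n)"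
  proof (rule PIO_intro)
    show "staircase B = (\<lambda>x. if x \<in> {Suc (Min B)..Max B}
        then Some (Min B + card (B \<inter> {Min B<..<x})) else None)"
      by (simp add: staircase_def)
    show "Min B + card (B \<inter> {Min B<..<Max B}) \<le> n"
      using card[of "Max B"] B bounds by simp
  qed (use B bounds in \<open>auto simp: card_Int_greaterThanLessThan_Suc\<close>)
  moreover have "y < x" if "staircase B x = Some y" for x y
    using that card[of x] by (auto simp: staircase_def split: if_splits)
  moreover have "{Min B<..<Suc (Min B)} = {}"
    by auto
  then have "staircase B (Suc (Min B)) = Some (Min B)"
    using B by (simp add: staircase_def)
  ultimately show ?thesis
    by (auto simp: unit_drop_maps_def N_PIO_minus_iff)
qed

lemma inj_on_staircase: "inj_on staircase {B. 2 \<le> card B}"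
proof (rule inj_onI, clarify)
  fix B C :: "nat set"
  assume cards: "2 \<le> card B" "2 \<le> card C" and eq: "staircase B = staircase C"
  note B = Min_less_Max[OF cards(1)] and C = Min_less_Max[OF cards(2)]
  have "dom (staircase D) = {Suc (Min D)..Max D}" for D
    by (auto simp: staircase_def dom_def)
  with eq have "{Suc (Min B)..Max B} = {Suc (Min C)..Max C}"
    by metis
  with B C have m: "Min B = Min C" and M: "Max B = Max C"
    by auto
  have val: "card (B \<inter> {Min B<..<x}) = card (C \<inter> {Min B<..<x})"
    if "Min B < x" "x \<le> Max B" for x
    using fun_cong[OF eq, of x] that m M by (simp add: staircase_def)
  have inner: "x \<in> B \<longleftrightarrow> x \<in> C" if "Min B < x" "x < Max B" for x
    using val[of x] val[of "Suc x"] that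
    by (auto simp: card_Int_greaterThanLessThan_Suc split: if_splits)
  have "x \<in> B \<longleftrightarrow> x \<in> C" for x
  proof (cases "Min B < x \<and> x < Max B")
    case True
    then show ?thesis
      using inner by blast
  next
    case False
    then show ?thesis
      using B C m M Min_le Max_ge by (metis antisym not_less)
  qed
  then show "B = C"
    by blast
qed

text \<open>Since values grow by at most one per step, \<open>x - x\<alpha>\<close> never decreases from left to right: a drop
  of one anywhere forces a drop of one at the left end of the domain.\<close>

lemma unit_drop_at_left_end:
  assumes \<alpha>: "\<alpha> \<in> unit_drop_maps n" and dom: "dom \<alpha> = {a..b}" "a \<le> b"
  shows "\<alpha> a = Some (a - 1)"
proof -
  have c: "\<alpha> \<in> carrier (PIO n)" and drop: "\<And>x y. \<alpha> x = Some y \<Longrightarrow> y < x"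
    using \<alpha> by (auto simp: unit_drop_maps_def N_PIO_minus_iff)
  obtain z where z: "\<alpha> (Suc z) = Some z"
    using \<alpha> by (auto simp: unit_drop_maps_def)
  have "a \<in> dom \<alpha>"
    using dom by simp
  then obtain w where w: "\<alpha> a = Some w"
    by blast
  have growth: "y \<le> w + (x - a)" if "a \<le> x" "x \<le> b" "\<alpha> x = Some y" for x y
    using that
  proof (induction x arbitrary: y rule: dec_induct)
    case base
    then show ?case
      using w by simp
  next
    case (step x)
    then have "x \<in> dom \<alpha>"
      using dom by simp
    then obtain u where u: "\<alpha> x = Some u"
      by blast
    show ?case
      using step.IH[OF _ u] step PIO_step[OF c u, of y] by auto
  qed
  have "Suc z \<in> {a..b}"
    using z dom by blast
  then show ?thesis
    using growth[OF _ _ z] w drop[OF w] by auto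
qed

lemma unit_drop_map_is_staircase:
  assumes \<alpha>: "\<alpha> \<in> unit_drop_maps n"
  obtains B where "B \<subseteq> {1..n}" "2 \<le> card B" "\<alpha> = staircase B"
proof -
  have c: "\<alpha> \<in> carrier (PIO n)"
    using \<alpha> by (simp add: unit_drop_maps_def N_PIO_minus_iff)
  have "\<alpha> \<noteq> Map.empty"
    using \<alpha> by (auto simp: unit_drop_maps_def)
  then obtain a b where ab: "1 \<le> a" "a \<le> b" "b \<le> n" and dom: "dom \<alpha> = {a..b}"
    using PIO_dom[OF c] by blast
  have left: "\<alpha> a = Some (a - 1)"
    using unit_drop_at_left_end[OF \<alpha> dom ab(2)] .
  have a2: "2 \<le> a"
    using PIO_bounds[OF c left] by simp
  define B where "B = {a - 1, b} \<union> {x \<in> {a..<b}. \<alpha> (Suc x) \<noteq> \<alpha> x}"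
  have fin: "finite B"
    by (simp add: B_def)
  have Min: "Min B = a - 1"
    using fin ab by (intro Min_eqI) (auto simp: B_def)
  have Max: "Max B = b"
    using fin ab by (intro Max_eqI) (auto simp: B_def)
  have "B \<subseteq> {1..n}"
    using ab a2 by (auto simp: B_def)
  moreover have "2 \<le> card B"
  proof -
    have "card {a - 1, b} \<le> card B"
      using fin by (intro card_mono) (auto simp: B_def)
    moreover have "a - 1 \<noteq> b"
      using ab by simp
    ultimately show ?thesis
      by simp
  qed
  moreover have "\<alpha> = staircase B"
  proof
    fix x
    have val: "\<alpha> x = Some (a - 1 + card (B \<inter> {a - 1<..<x}))" if "a \<le> x" "x \<le> b" for x
      using that
    proof (induction x rule: dec_induct)
      case base
      have "{a - 1<..<a} = {}"
        by auto
      then show ?case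
        using left by simp
    next
      case (step x)
      then have u: "\<alpha> x = Some (a - 1 + card (B \<inter> {a - 1<..<x}))"
        by simp
      have "Suc x \<in> dom \<alpha>"
        using step dom by simp
      then obtain v where v: "\<alpha> (Suc x) = Some v"
        by blast
      have "x \<in> B \<longleftrightarrow> \<alpha> (Suc x) \<noteq> \<alpha> x"
        using step ab by (auto simp: B_def)
      with PIO_step[OF c u v] u v step ab show ?case
        by (auto simp: card_Int_greaterThanLessThan_Suc)
    qed
    have "Suc (a - 1) = a"
      using ab by simp
    moreover have "\<alpha> x = None" if "x \<notin> {a..b}"
      using that dom by blast
    ultimately show "\<alpha> x = staircase B x"
      using val[of x] by (simp add: staircase_def Min Max)
  qed
  ultimately show thesis
    using that by blast
qed

lemma bij_betw_staircase:
  "bij_betw staircase {B. B \<subseteq> {1..n} \<and> 2 \<le> card B} (unit_drop_maps n)"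
  unfolding bij_betw_def
proof
  show "inj_on staircase {B. B \<subseteq> {1..n} \<and> 2 \<le> card B}"
    by (rule inj_on_subset[OF inj_on_staircase]) auto
  show "staircase ` {B. B \<subseteq> {1..n} \<and> 2 \<le> card B} = unit_drop_maps n"
    using staircase_in_unit_drop_maps unit_drop_map_is_staircase by (auto simp: image_iff) metis
qed

lemma card_subsets_at_least_two:
  assumes "finite A"
  shows "card {B. B \<subseteq> A \<and> 2 \<le> card B} = 2 ^ card A - card A - 1"
proof -
  let ?small = "insert {} ((\<lambda>x. {x}) ` A)"
  have "{B. B \<subseteq> A \<and> 2 \<le> card B} = Pow A - ?small"
  proof (intro subset_antisym subsetI)
    fix B assume B: "B \<in> Pow A - ?small"
    then have "finite B"
      using assms finite_subset by blast
    with B have "card B \<noteq> 0" "card B \<noteq> 1"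
      by (auto simp: card_1_singleton_iff)
    with B show "B \<in> {B. B \<subseteq> A \<and> 2 \<le> card B}"
      by auto
  qed auto
  moreover have "card ?small = Suc (card A)"
    using assms by (subst card_insert_disjoint) (auto simp: card_image)
  moreover have "card (Pow A - ?small) = card (Pow A) - card ?small"
    using assms by (intro card_Diff_subset) auto
  ultimately show ?thesis
    using assms by (simp add: card_Pow)
qed

theorem theorem15:
  fixes n :: nat
  assumes "n \<ge> 2"
  shows "semigroup_rank (PIO_minus n) (N_PIO_minus n) = 2 ^ n - n - 1"
proof -
  have "semigroup_rank (PIO_minus n) (N_PIO_minus n) = card (unit_drop_maps n)"
  proof (rule semigroup_rank_eq_card)
    show "unit_drop_maps n \<subseteq> N_PIO_minus n"
      by (auto simp: unit_drop_maps_def)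
  qed (simp_all add: finite_N_PIO_minus generated_by_unit_drop_maps[OF assms]
      unit_drop_maps_indecomposable)
  also have "\<dots> = card {B. B \<subseteq> {1..n} \<and> 2 \<le> card B}"
    using bij_betw_same_card[OF bij_betw_staircase] by simp
  also have "\<dots> = 2 ^ n - n - 1"
    by (simp add: card_subsets_at_least_two)
  finally show ?thesis .
qed

end
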